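(* Let $0<\delta<1$, and let $y_0,y_1,y_2,\ldots\in C[0,1]$ be the solution components of the homotopy analysis scheme (with convergence-control parameter $c_0\neq 0$) described in the context. Suppose there exists $k_0\in\mathbb{N}$ such that $\|y_{k+1}\|\le \delta\,\|y_k\|$ for all $k\ge k_0$. Then the series $\sum_{k=0}^{\infty} y_k(x)$ is convergent in the Banach space $C[0,1]$ with norm $\|y\|=\max_{x\in[0,1]}|y(x)|$.
   Context: $C[0,1]$ is the Banach space of continuous real functions on $[0,1]$ with the norm $\|y\|=\max_{x\in[0,1]}|y(x)|$. Consider the nonlocal boundary value problem $\alpha(p)\,y''(x)=f(y(x))$, $x\in(0,1)$, $y(0)=a$, $y(1)=b$, with $a,b\in[0,\infty)$ and $p=\int_0^1 y(s)\,ds$. Here $\alpha$ is a continuous positive function, and either $f(y(x))\equiv -h(x)$ for a given function $h$, or $f(y(x))\equiv y^{2n+1}(x)$ with $n$ a nonnegative integer. It is rewritten as the integral equation $$y(x)=a+(b-a)x+\frac{1}{\alpha(p)}\int_0^1 G(x,s)f(y(s))\,ds,$$ where $G(x,s)=x(s-1)$ for $x\le s$ and $G(x,s)=s(x-1)$ for $s\le x$. Solution components: fix a real number $c_0\neq 0$ (the convergence-control parameter). Put $y_0(x)=a+(b-a)x$ and, for $k\ge 1$, $$y_k(x)-\chi_k\,y_{k-1}(x)=c_0\Big[y_{k-1}(x)-(1-\chi_k)\big(a+(b-a)x\big)-\frac{1}{\alpha(p_{k-1})}\int_0^1 G(x,s)\,\mathcal{H}_{k-1}(s)\,ds\Big],$$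 where $\chi_k=0$ for $k\le 1$ and $\chi_k=1$ for $k>1$, $p_k=\int_0^1\sum_{m=0}^{k}y_m(s)\,ds$, and $$\mathcal{H}_k(s)=\frac{1}{k!}\frac{\partial^k}{\partial q^k}\Big\{f\Big(\sum_{m=0}^{k}y_m(s)q^m\Big)\Big\}\Big|_{q=0}$$ (so when $f\equiv -h$, $\mathcal{H}_0=-h$ and $\mathcal{H}_k=0$ for $k\ge1$). The components $y_k$ (which depend on $c_0$) are regarded as elements of $C[0,1]$. *)

theory Defs
  imports "HOL-Analysis.Analysis"
begin

text \<open>
  The space \<open>C[0,1]\<close> is the library's complete metric space of continuous functions on the
  subspace \<open>{0..1}\<close> of the reals. Its points are extensional: they are \<open>undefined\<close> outside
  \<open>{0..1}\<close>, so equality of points is equality on \<open>[0,1]\<close>.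
\<close>

definition C01 :: "(real \<Rightarrow> real) metric" where
  "C01 = cfunspace (top_of_set {0..1}) euclidean_metric"

text \<open>By \<open>norm_C01_attained\<close> and \<open>mdist_C01\<close> below, this supremum is a maximum, and the metric of
  \<open>C01\<close> is the one induced by this norm.\<close>

definition norm_C01 :: "(real \<Rightarrow> real) \<Rightarrow> real" where
  "norm_C01 y = (SUP x\<in>{0..1}. \<bar>y x\<bar>)"

definition series_converges_C01 :: "(nat \<Rightarrow> real \<Rightarrow> real) \<Rightarrow> bool" where
  "series_converges_C01 y \<longleftrightarrow>
     (\<exists>S. limitin (mtopology_of C01) (\<lambda>n. \<lambda>x\<in>{0..1}. \<Sum>k<n. y k x) S sequentially)"

lemma mspace_C01_iff:
  "y \<in> mspace C01 \<longleftrightarrow> y \<in> extensional {0..1} \<and> continuous_on {0..1} y"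
proof -
  have "compactin (top_of_set {0..1::real}) (topspace (top_of_set {0..1}))"
    by (simp add: compactin_subtopology)
  from compactin_mspace_cfunspace[OF this, of euclidean_metric] show ?thesis
    by (auto simp: C01_def)
qed

lemma norm_C01_attained:
  assumes "y \<in> mspace C01"
  shows "\<exists>x\<in>{0..1}. norm_C01 y = \<bar>y x\<bar> \<and> (\<forall>t\<in>{0..1}. \<bar>y t\<bar> \<le> \<bar>y x\<bar>)"
proof -
  have "continuous_on {0..1} (\<lambda>x. \<bar>y x\<bar>)"
    using assms by (auto simp: mspace_C01_iff intro: continuous_intros)
  then obtain x where x: "x \<in> {0..1}" "\<forall>t\<in>{0..1}. \<bar>y t\<bar> \<le> \<bar>y x\<bar>"
    using continuous_attains_sup[of "{0..1::real}" "\<lambda>x. \<bar>y x\<bar>"] by auto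
  then have "norm_C01 y = \<bar>y x\<bar>"
    unfolding norm_C01_def by (intro cSup_eq_maximum) auto
  with x show ?thesis by blast
qed

lemma mdist_C01:
  assumes "f \<in> mspace C01" "g \<in> mspace C01"
  shows "mdist C01 f g = norm_C01 (\<lambda>x. f x - g x)"
proof -
  have "f \<in> Met_TC.fspace {0..1}" "g \<in> Met_TC.fspace {0..1}"
    using assms cfunspace_subset_funspace[of "top_of_set {0..1::real}" "euclidean_metric :: real metric"]
    by (auto simp: C01_def Met_TC.fspace_def)
  then show ?thesis
    by (simp add: C01_def norm_C01_def mdist_cfunspace_eq_mdist_funspace Met_TC.fdist_def
        Metric_space.fdist_def Metric_space.fspace_def dist_real_def)
qed

definition G :: "real \<Rightarrow> real \<Rightarrow> real" where
  "G x s = (if x \<le> s then x * (s - 1) else s * (x - 1))"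

text \<open>
  The right-hand side \<open>f(y(s))\<close> is encoded as \<open>f s (y s)\<close>, so that \<open>f(y(s)) \<equiv> -h(s)\<close>, which
  depends on \<open>s\<close> alone, and \<open>f(y(s)) \<equiv> y(s)^(2n+1)\<close> are instances of one type.
\<close>

definition admissible_rhs :: "(real \<Rightarrow> real \<Rightarrow> real) \<Rightarrow> bool" where
  "admissible_rhs f \<longleftrightarrow>
     (\<exists>h. f = (\<lambda>s v. - h s)) \<or> (\<exists>n::nat. f = (\<lambda>s v. v ^ (2 * n + 1)))"

definition chi :: "nat \<Rightarrow> real" where
  "chi k = (if k \<le> 1 then 0 else 1)"

definition p_HAM :: "(nat \<Rightarrow> real \<Rightarrow> real) \<Rightarrow> nat \<Rightarrow> real" where
  "p_HAM y k = integral {0..1} (\<lambda>s. \<Sum>m\<le>k. y m s)"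

definition H_HAM ::
  "(real \<Rightarrow> real \<Rightarrow> real) \<Rightarrow> (nat \<Rightarrow> real \<Rightarrow> real) \<Rightarrow> nat \<Rightarrow> real \<Rightarrow> real" where
  "H_HAM f y k s = (deriv ^^ k) (\<lambda>q. f s (\<Sum>m\<le>k. y m s * q ^ m)) 0 / fact k"

lemma H_HAM_source:
  "H_HAM (\<lambda>s v. - h s) y k s = (if k = 0 then - h s else 0)"
proof -
  have "(deriv ^^ k) (\<lambda>q::real. 0) = (\<lambda>q. 0 :: real)" for k
    by (induction k) auto
  then show ?thesis
    by (cases k) (simp_all add: H_HAM_def funpow_swap1[symmetric] funpow_Suc_right del: funpow.simps)
qed

text \<open>
  \<open>D\<close> is the domain of the coefficient \<open>\<alpha>\<close>. The second and third conjuncts say that the formula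
  for the components is meaningful: \<open>\<alpha>\<close> is evaluated inside its domain and the integrals
  exist (\<open>integral\<close> is \<open>0\<close> on non-integrable functions).
\<close>

definition HAM_components ::
  "real set \<Rightarrow> (real \<Rightarrow> real) \<Rightarrow> (real \<Rightarrow> real \<Rightarrow> real) \<Rightarrow> real \<Rightarrow> real \<Rightarrow> real \<Rightarrow>
   (nat \<Rightarrow> real \<Rightarrow> real) \<Rightarrow> bool" where
  "HAM_components D \<alpha> f a b c0 y \<longleftrightarrow>
     (\<forall>x\<in>{0..1}. y 0 x = a + (b - a) * x) \<and>
     (\<forall>k. p_HAM y k \<in> D) \<and>
     (\<forall>k. \<forall>x\<in>{0..1}. (\<lambda>s. G x s * H_HAM f y k s) integrable_on {0..1}) \<and>
     (\<forall>k\<ge>1. \<forall>x\<in>{0..1}.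
        y k x - chi k * y (k - 1) x =
        c0 * (y (k - 1) x - (1 - chi k) * (a + (b - a) * x)
              - 1 / \<alpha> (p_HAM y (k - 1)) *
                integral {0..1} (\<lambda>s. G x s * H_HAM f y (k - 1) s)))"

end

theory Submission
  imports Defs
begin

text \<open>
  The ratio condition makes the norms of the components decay geometrically from the index
  \<open>k0\<close> on, so they are summable. As these norms dominate the components pointwise on \<open>[0,1]\<close>,
  the Weierstrass M-test makes the partial sums converge uniformly there
  (\<open>normally_convergent_imp_series_converges_C01\<close>). A uniform limit of continuous functions is
  continuous, and uniform convergence on \<open>[0,1]\<close> is convergence in the metric of the space
  (\<open>uniform_limit_imp_limitin_C01\<close>).
\<close>

lemma abs_le_norm_C01:
  assumes "y \<in> mspace C01" and "x \<in> {0..1}"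
  shows "\<bar>y x\<bar> \<le> norm_C01 y"
  using norm_C01_attained[OF assms(1)] assms(2) by auto

lemma norm_C01_nonneg:
  assumes "y \<in> mspace C01"
  shows "0 \<le> norm_C01 y"
  using norm_C01_attained[OF assms] by auto

text \<open>Points of the space are extensional, so the limit must be restricted to \<open>[0,1]\<close>; the
  uniform limit itself may take any values elsewhere.\<close>

lemma uniform_limit_imp_limitin_C01:
  assumes F: "\<And>n. F n \<in> mspace C01"
    and lim: "uniform_limit {0..1} F S sequentially"
  shows "limitin (mtopology_of C01) F (restrict S {0..1}) sequentially"
proof -
  have "continuous_on {0..1} S"
    using F by (intro uniform_limit_theorem[OF _ lim]) (auto simp: mspace_C01_iff)
  then have S: "restrict S {0..1} \<in> mspace C01"
    by (simp add: mspace_C01_iff cong: continuous_on_cong_simp)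
  have "\<forall>\<^sub>F n in sequentially. mdist C01 (F n) (restrict S {0..1}) < \<epsilon>" if "\<epsilon> > 0" for \<epsilon>
  proof -
    \<comment> \<open>Pointwise bounds pass to the supremum only as weak inequalities, hence \<open>\<epsilon> / 2\<close>.\<close>
    have "\<forall>\<^sub>F n in sequentially. \<forall>x\<in>{0..1}. dist (F n x) (S x) < \<epsilon> / 2"
      using that by (intro uniform_limitD[OF lim]) simp
    then show ?thesis
    proof eventually_elim
      case (elim n)
      have "norm_C01 (\<lambda>x. F n x - restrict S {0..1} x) \<le> \<epsilon> / 2"
        unfolding norm_C01_def using elim
        by (intro cSUP_least) (auto simp: dist_real_def intro: less_imp_le)
      then show ?case
        using that by (simp add: mdist_C01[OF F S])
    qed
  qed
  then show ?thesis
    using F S by (simp add: mtopology_of_def Metric_space.limitin_metric)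
qed

lemma normally_convergent_imp_series_converges_C01:
  assumes y: "\<And>k. y k \<in> mspace C01"
    and summable: "summable (\<lambda>k. norm_C01 (y k))"
  shows "series_converges_C01 y"
proof -
  let ?P = "\<lambda>n. \<lambda>x\<in>{0..1}. \<Sum>k<n. y k x"
  have P: "?P n \<in> mspace C01" for n
    using y by (auto simp: mspace_C01_iff cong: continuous_on_cong_simp
        intro!: continuous_on_sum)
  have "uniform_limit {0..1} (\<lambda>n x. \<Sum>k<n. y k x) (\<lambda>x. \<Sum>k. y k x) sequentially"
    using abs_le_norm_C01[OF y] summable by (intro Weierstrass_m_test) auto
  then have "uniform_limit {0..1} ?P (\<lambda>x. \<Sum>k. y k x) sequentially"
    by (rule uniform_limit_cong'[THEN iffD1, rotated -1]) auto
  with P show ?thesis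
    unfolding series_converges_C01_def by (blast intro: uniform_limit_imp_limitin_C01)
qed

theorem theorem3p1:
  fixes \<alpha> :: "real \<Rightarrow> real" and D :: "real set"
    and f :: "real \<Rightarrow> real \<Rightarrow> real"
    and a b c0 \<delta> :: real
    and y :: "nat \<Rightarrow> real \<Rightarrow> real"
  assumes "continuous_on D \<alpha>" and "\<forall>p\<in>D. \<alpha> p > 0"
    and "admissible_rhs f"
    and "a \<ge> 0" and "b \<ge> 0"
    and "c0 \<noteq> 0"
    and "0 < \<delta>" and "\<delta> < 1"
    and "\<forall>k. y k \<in> mspace C01"
    and "HAM_components D \<alpha> f a b c0 y"
    and "\<exists>k0. \<forall>k\<ge>k0. norm_C01 (y (k + 1)) \<le> \<delta> * norm_C01 (y k)"
  shows "series_converges_C01 y"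
proof -
  have y: "y k \<in> mspace C01" for k
    using assms(9) by simp
  obtain k0 where "\<forall>k\<ge>k0. norm_C01 (y (k + 1)) \<le> \<delta> * norm_C01 (y k)"
    using assms(11) by blast
  then have "summable (\<lambda>k. norm_C01 (y k))"
    using norm_C01_nonneg[OF y] \<open>\<delta> < 1\<close>
    by (intro summable_ratio_test[of \<delta> k0]) auto
  with y show ?thesis
    by (rule normally_convergent_imp_series_converges_C01)
qed

end
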